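(* Let $p>0$ and let $\xi_1,\dots,\xi_n$ be independent random variables satisfying the $(\alpha,\beta)$-condition for some $\alpha,\beta>0$. Let $0<x_1\leq\dots\leq x_n$ be real numbers, and for each $j\leq n$ set $b_j:=\sum_{i=j}^n 1/x_i$. Then for every integer $1\leq k\leq n$ we have $$\frac12\left(\frac{1}{16\alpha}\right)^p\sum_{j=1}^k\frac{(k-j+1)^p}{b_j^p}\;\leq\;\mathbb{E}\sum_{j=1}^{k} j\text{-}\min_{1\leq i\leq n}|x_i\xi_i|^p\;\leq\; W(\beta,p)\sum_{j=1}^k\frac{(k-j+1)^p}{b_j^p},$$ where $W(\beta,p):=\beta^{-p}\,\Gamma(1+p)\,\big(1+2\cdot 4^p\big)$.
   Context: For a real sequence $a_1,\dots,a_n$ and $1\leq j\leq n$, $j\text{-}\min_{1\leq i\leq n}a_i$ denotes its $j$-th smallest element (counted with multiplicity). A random variable $\xi$ satisfies the $(\alpha,\beta)$-condition if $\mathbb{P}(|\xi|\leq t)\leq \alpha t$ for every $t\geq 0$ and $\mathbb{P}(|\xi|>t)\leq e^{-\beta t}$ for every $t\geq 0$. $\Gamma$ is the Gamma function. *)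

theory Defs
  imports "HOL-Probability.Probability"
begin

text \<open>The \<open>j\<close>-th smallest element, counted with multiplicity, of \<open>a 1, \<dots>, a n\<close>;
  meaningful only for \<open>1 \<le> j \<le> n\<close>.\<close>

definition j_min :: "nat \<Rightarrow> nat \<Rightarrow> (nat \<Rightarrow> real) \<Rightarrow> real" where
  "j_min j n a = sort (map a [1..<Suc n]) ! (j - 1)"

definition alpha_beta_condition :: "'a measure \<Rightarrow> real \<Rightarrow> real \<Rightarrow> ('a \<Rightarrow> real) \<Rightarrow> bool" where
  "alpha_beta_condition M \<alpha> \<beta> \<xi> \<longleftrightarrow>
     \<xi> \<in> borel_measurable M \<and>
     (\<forall>t\<ge>0. measure M {\<omega> \<in> space M. \<bar>\<xi> \<omega>\<bar> \<le> t} \<le> \<alpha> * t) \<and>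
     (\<forall>t\<ge>0. measure M {\<omega> \<in> space M. \<bar>\<xi> \<omega>\<bar> > t} \<le> exp (- \<beta> * t))"

definition W :: "real \<Rightarrow> real \<Rightarrow> real" where
  "W \<beta> p = \<beta> powr (- p) * Gamma (1 + p) * (1 + 2 * 4 powr p)"

end

theory Submission
  imports Defs
begin

text \<open>
  Write \<open>Z i = \<bar>x i * \<xi> i\<bar>\<close>, \<open>w i = 1 / x i\<close>, and let \<open>N t\<close> be the number of \<open>i\<close> with \<open>Z i \<le> t\<close>. The sum
  of the \<open>k\<close> smallest \<open>Z i powr p\<close> is the minimum of the sums over \<open>k\<close>-element index sets.

  Lower bound: by the layer cake formula the expectation is at least the integral of
  \<open>p * t powr (p - 1) * max 0 (k - E (N t))\<close>, where \<open>E (N t)\<close> is at most the sum of all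
  \<open>min 1 (\<alpha> * t * w i)\<close>. If \<open>m\<close> is the least \<open>j\<close> with \<open>2 * \<alpha> * t * b j < k - j + 1\<close>, bounding the
  first \<open>m - 1\<close> terms by \<open>1\<close> and the others by \<open>\<alpha> * t * w i\<close> gives \<open>E (N t) \<le> m - 1 + (k - m + 1) / 2\<close>.
  Hence \<open>k - E (N t)\<close> is at least half the number of such \<open>j\<close>, and integrating over \<open>t\<close> yields the
  bound even with \<open>2\<close> in place of \<open>16\<close>.

  Upper bound: for disjoint nonempty \<open>A 1, \<dots>, A k\<close> the sum is at most the sum of the minima over
  the \<open>A r\<close>, and by independence such a minimum has an exponential tail with rate \<open>\<beta> * sum w (A r)\<close>.
  Take singletons below the least \<open>m\<close> with \<open>w m * (k - m + 1) \<le> b m\<close>; from \<open>m\<close> on no weight exceeds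
  \<open>b m / (k - m + 1)\<close>, so \<open>{m..n}\<close> contains \<open>k - m + 1\<close> disjoint sets of weight at least half of that.
\<close>

subsection \<open>Sums of the smallest elements\<close>

text \<open>Sorting the indices by their values, rather than the values themselves, records which
  index yields each order statistic. The first \<open>k\<close> sorted indices form
  \<open>S\<close>, also when values tie. The final clause makes \<open>S\<close> comparable with
  every other index set of the same size.\<close>

lemma sum_j_min_eq_sum_subset:
  assumes "k \<le> n"
  obtains S where "S \<subseteq> {1..n}" "card S = k" "(\<Sum>j=1..k. j_min j n a) = sum a S"
    "\<And>i i'. i \<in> S \<Longrightarrow> i' \<in> {1..n} - S \<Longrightarrow> a i \<le> a i'"
proof -
  define zs where "zs = sort_key a [1..<Suc n]"
  have sort_map: "sort (map a [1..<Suc n]) = map a zs"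
    by (rule properties_for_sort) (auto simp: zs_def)
  have len: "length zs = n" and dist: "distinct zs" and set: "set zs = {1..n}"
    by (auto simp: zs_def)
  have "(\<Sum>j=1..k. j_min j n a) = (\<Sum>j=1..k. a (zs ! (j - 1)))"
    unfolding j_min_def sort_map using assms by (intro sum.cong nth_map refl) (auto simp: len)
  also have "\<dots> = (\<Sum>i<k. a (zs ! i))"
    by (rule sum.reindex_bij_witness[of _ Suc "\<lambda>j. j - 1"]) auto
  also have "\<dots> = sum_list (map a (take k zs))"
    using assms len by (simp add: sum_list_sum_nth atLeast0LessThan)
  also have "\<dots> = sum a (set (take k zs))"
    using dist by (simp add: sum_list_distinct_conv_sum_set)
  finally have "(\<Sum>j=1..k. j_min j n a) = sum a (set (take k zs))" .
  moreover have "a i \<le> a i'" if "i \<in> set (take k zs)" "i' \<in> {1..n} - set (take k zs)" for i i'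
  proof -
    have "i' \<in> set (take k zs) \<union> set (drop k zs)"
      using that(2) set by (metis DiffD1 append_take_drop_id set_append)
    then have "i' \<in> set (drop k zs)"
      using that(2) by blast
    moreover have "sorted (map a (take k zs @ drop k zs))"
      by (simp add: zs_def)
    ultimately show ?thesis
      using that(1) unfolding map_append sorted_append by simp
  qed
  moreover have "set (take k zs) \<subseteq> {1..n}" "card (set (take k zs)) = k"
    using set dist assms len set_take_subset[of k zs] by (auto simp: distinct_card)
  ultimately show ?thesis
    using that by blast
qed

text \<open>The common part cancels. The differences \<open>S - I\<close> and \<open>I - S\<close>
  have the same cardinality, and every value on the first is at most every value on the
  second.\<close>

lemma sum_le_sum_of_separated:
  fixes a :: "'b \<Rightarrow> real"
  assumes "finite S" "finite I" "card S = card I"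
    and le: "\<And>i i'. i \<in> S \<Longrightarrow> i' \<in> I - S \<Longrightarrow> a i \<le> a i'"
  shows "sum a S \<le> sum a I"
proof -
  have card: "card (S - I) = card (I - S)"
    using assms(1-3) by (simp add: card_le_sym_Diff card_less_sym_Diff le_antisym)
  have "sum a (S - I) \<le> sum a (I - S)"
  proof (cases "S - I = {}")
    case True
    then have "card (I - S) = 0"
      using card by (metis card.empty)
    then have "I - S = {}"
      using assms(2) by (metis card_0_eq finite_Diff)
    with True show ?thesis
      by (metis order_refl)
  next
    case False
    \<comment> \<open>A single number that separates the values on the two differences;
      \<open>Max\<close> is meaningful since \<open>S - I\<close> is nonempty in this case.\<close>
    define m where "m = Max (a ` (S - I))"
    have "\<And>i. i \<in> S - I \<Longrightarrow> a i \<le> m"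
      using assms(1) by (simp add: m_def)
    moreover have "m \<in> a ` (S - I)"
      unfolding m_def using False assms(1) by (intro Max_in) auto
    then have "\<And>i. i \<in> I - S \<Longrightarrow> m \<le> a i"
      using le by auto
    ultimately have "sum a (S - I) \<le> card (S - I) * m" "card (I - S) * m \<le> sum a (I - S)"
      by (auto intro: sum_bounded_above sum_bounded_below)
    then show ?thesis
      using card by simp
  qed
  moreover have "sum a S = sum a (S \<inter> I) + sum a (S - I)" "sum a I = sum a (S \<inter> I) + sum a (I - S)"
    using assms(1,2) sum.Int_Diff[of S a I] sum.Int_Diff[of I a S] by (simp_all add: Int_commute)
  ultimately show ?thesis
    by simp
qed

lemma sum_j_min_le_sum:
  assumes "I \<subseteq> {1..n}"
  shows "(\<Sum>j=1..card I. j_min j n a) \<le> sum a I"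
proof -
  have "finite I"
    using assms finite_subset by blast
  have "card I \<le> n"
    using assms card_mono[of "{1..n}" I] by simp
  obtain S where S: "S \<subseteq> {1..n}" "card S = card I"
    "(\<Sum>j=1..card I. j_min j n a) = sum a S"
    "\<And>i i'. i \<in> S \<Longrightarrow> i' \<in> {1..n} - S \<Longrightarrow> a i \<le> a i'"
    using sum_j_min_eq_sum_subset[OF \<open>card I \<le> n\<close>, of a] by metis
  have "sum a S \<le> sum a I"
  proof (rule sum_le_sum_of_separated)
    show "finite S"
      using S(1) finite_subset by blast
    show "a i \<le> a i'" if "i \<in> S" "i' \<in> I - S" for i i'
      using S(4) that assms by blast
  qed (use S(2) \<open>finite I\<close> in auto)
  then show ?thesis
    unfolding S(3) .
qed

text \<open>This form serves measurability: a minimum of finitely many finite sums of measurable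
  functions is measurable, so nothing has to be shown about \<open>sort\<close>.\<close>

lemma sum_j_min_eq_Min:
  assumes "k \<le> n"
  shows "(\<Sum>j=1..k. j_min j n a) = Min ((\<lambda>I. sum a I) ` {I. I \<subseteq> {1..n} \<and> card I = k})"
proof (rule Min_eqI[symmetric])
  show "finite ((\<lambda>I. sum a I) ` {I. I \<subseteq> {1..n} \<and> card I = k})"
    by simp
  show "(\<Sum>j=1..k. j_min j n a) \<le> y"
    if "y \<in> (\<lambda>I. sum a I) ` {I. I \<subseteq> {1..n} \<and> card I = k}" for y
    using that sum_j_min_le_sum by auto
  show "(\<Sum>j=1..k. j_min j n a) \<in> (\<lambda>I. sum a I) ` {I. I \<subseteq> {1..n} \<and> card I = k}"
    by (rule sum_j_min_eq_sum_subset[OF assms, of a]) blast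
qed

lemma borel_measurable_sum_j_min:
  assumes "\<And>i. i \<in> {1..n} \<Longrightarrow> f i \<in> borel_measurable M" "k \<le> n"
  shows "(\<lambda>\<omega>. \<Sum>j=1..k. j_min j n (\<lambda>i. f i \<omega>)) \<in> borel_measurable M"
  unfolding sum_j_min_eq_Min[OF assms(2)]
  by (intro borel_measurable_Min borel_measurable_sum) (use assms in auto)

text \<open>An index attaining the minimum is chosen in each \<open>A r\<close>. Disjointness makes
  the choices distinct, so they form a competing index set of size \<open>k\<close>.\<close>

lemma sum_j_min_le_sum_Min:
  assumes "disjoint_family_on A {1..k}"
    and A: "\<And>r. r \<in> {1..k} \<Longrightarrow> A r \<noteq> {} \<and> A r \<subseteq> {1..n}"
  shows "(\<Sum>j=1..k. j_min j n a) \<le> (\<Sum>r=1..k. Min (a ` A r))"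
proof -
  have "\<exists>i\<in>A r. a i = Min (a ` A r)" if "r \<in> {1..k}" for r
  proof -
    have "Min (a ` A r) \<in> a ` A r"
      using A[OF that] finite_subset by (intro Min_in) auto
    then show ?thesis
      by auto
  qed
  then obtain i where i: "\<And>r. r \<in> {1..k} \<Longrightarrow> i r \<in> A r \<and> a (i r) = Min (a ` A r)"
    by metis
  then have inj: "inj_on i {1..k}"
    using disjoint_family_onD[OF assms(1)] by (intro inj_onI) (metis disjoint_iff)
  have "(\<Sum>j=1..k. j_min j n a) \<le> sum a (i ` {1..k})"
    using sum_j_min_le_sum[of "i ` {1..k}" n a] i A card_image[OF inj] by fastforce
  also have "\<dots> = (\<Sum>r=1..k. Min (a ` A r))"
    using i inj by (simp add: sum.reindex)
  finally show ?thesis .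
qed

subsection \<open>Layer cake formula\<close>

text \<open>The half-open interval expresses the event \<open>t < z\<close>, whose probability is a
  tail; it differs from the closed interval by a null set.\<close>

lemma ennreal_powr_layer_cake:
  fixes z p :: real
  assumes "0 \<le> z" "0 < p"
  shows "ennreal (z powr p) =
    (\<integral>\<^sup>+t. ennreal (p * t powr (p - 1)) * indicator {0..<z} t \<partial>lborel)"
proof -
  have "((\<lambda>t. p * t powr (p - 1)) has_integral p * (z powr (p - 1 + 1) / (p - 1 + 1))) {0..z}"
    using assms by (intro has_integral_mult_right has_integral_powr_from_0) auto
  then have "(\<integral>\<^sup>+t. ennreal (p * t powr (p - 1)) * indicator {0..z} t \<partial>lborel) = ennreal (z powr p)"
    using assms by (subst nn_integral_has_integral_lebesgue') auto
  moreover have "AE t in lborel. t \<noteq> z"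
    by (rule AE_lborel_singleton)
  then have "(\<integral>\<^sup>+t. ennreal (p * t powr (p - 1)) * indicator {0..<z} t \<partial>lborel)
     = (\<integral>\<^sup>+t. ennreal (p * t powr (p - 1)) * indicator {0..z} t \<partial>lborel)"
    by (intro nn_integral_cong_AE) (auto simp: indicator_def)
  ultimately show ?thesis
    by simp
qed

text \<open>The substitution of \<open>l * t\<close> reduces this to the Gamma integral, with
  \<open>p * Gamma p = Gamma (1 + p)\<close>.\<close>

lemma nn_integral_powr_times_exp:
  fixes p l :: real
  assumes "0 < p" "0 < l"
  shows "(\<integral>\<^sup>+t. ennreal (p * t powr (p - 1)) * indicator {0..} t * ennreal (exp (- l * t)) \<partial>lborel)
    = ennreal (Gamma (1 + p) * l powr (- p))"
proof -
  have "Gamma (1 + p) = p * Gamma p"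
    using Gamma_plus1[of p] assms by (simp add: add.commute nonpos_Ints_def)
  moreover have "((\<lambda>t. p * (t powr (p - 1) / exp t)) has_integral p * Gamma p) {0..}"
    using assms by (intro has_integral_mult_right Gamma_integral_real)
  ultimately have unit: "(\<integral>\<^sup>+t. ennreal (p * (t powr (p - 1) / exp t)) * indicator {0..} t \<partial>lborel)
     = ennreal (Gamma (1 + p))"
    using assms by (subst nn_integral_has_integral_lebesgue') auto
  have "ennreal (p * t powr (p - 1)) * indicator {0..} t * ennreal (exp (- l * t))
     = ennreal (l powr (1 - p)) *
       (ennreal (p * ((l * t) powr (p - 1) / exp (l * t))) * indicator {0..} (l * t))" for t
  proof (cases "t \<ge> 0")
    case True
    have "l powr (1 - p) * l powr (p - 1) = 1"
      using assms by (simp flip: powr_add)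
    then have "p * t powr (p - 1) * exp (- l * t)
        = l powr (1 - p) * (p * ((l * t) powr (p - 1) / exp (l * t)))"
      using assms True by (simp add: powr_mult exp_minus field_simps)
    then show ?thesis
      using assms True by (simp flip: ennreal_mult add: mult.assoc)
  qed (use assms in \<open>simp add: indicator_def zero_le_mult_iff\<close>)
  then have "(\<integral>\<^sup>+t. ennreal (p * t powr (p - 1)) * indicator {0..} t * ennreal (exp (- l * t)) \<partial>lborel)
     = ennreal (l powr (1 - p)) *
        (\<integral>\<^sup>+t. ennreal (p * ((l * t) powr (p - 1) / exp (l * t))) * indicator {0..} (l * t) \<partial>lborel)"
    by (simp add: nn_integral_cmult)
  \<comment> \<open>The split-off factor \<open>l\<close> is the Jacobian of the substitution in the
    next step.\<close>
  also have "l powr (1 - p) = l powr (- p) * l"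
    using assms by (simp add: powr_diff powr_minus field_simps)
  also have "ennreal (l powr (- p) * l) *
      (\<integral>\<^sup>+t. ennreal (p * ((l * t) powr (p - 1) / exp (l * t))) * indicator {0..} (l * t) \<partial>lborel)
      = ennreal (l powr (- p)) *
      (\<integral>\<^sup>+t. ennreal (p * (t powr (p - 1) / exp t)) * indicator {0..} t \<partial>lborel)"
    using assms
    by (subst (2) nn_integral_real_affine[where c = l and t = 0]) (auto simp: ennreal_mult mult.assoc)
  also have "\<dots> = ennreal (Gamma (1 + p) * l powr (- p))"
    unfolding unit using assms by (simp add: ennreal_mult' mult.commute)
  finally show ?thesis .
qed

lemma (in prob_space) nn_integral_powr_le_of_exp_tail:
  fixes Z :: "'a \<Rightarrow> real"
  assumes [measurable]: "Z \<in> borel_measurable M"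
    and "0 < p" "0 < l" "\<And>\<omega>. \<omega> \<in> space M \<Longrightarrow> 0 \<le> Z \<omega>"
    and tail: "\<And>t. 0 \<le> t \<Longrightarrow> prob {\<omega>\<in>space M. Z \<omega> > t} \<le> exp (- l * t)"
  shows "(\<integral>\<^sup>+\<omega>. ennreal (Z \<omega> powr p) \<partial>M) \<le> ennreal (Gamma (1 + p) * l powr (- p))"
proof -
  interpret L: pair_sigma_finite M lborel ..
  have "(\<integral>\<^sup>+\<omega>. ennreal (Z \<omega> powr p) \<partial>M) =
    (\<integral>\<^sup>+\<omega>. (\<integral>\<^sup>+t. ennreal (p * t powr (p - 1)) * indicator {0..<Z \<omega>} t \<partial>lborel) \<partial>M)"
    using assms by (intro nn_integral_cong ennreal_powr_layer_cake) auto
  \<comment> \<open>The interval depends on \<omega>; as a condition on the pair of \<omega> and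
    \<open>t\<close> it is jointly measurable, as \<open>Fubini'\<close> requires.\<close>
  also have "\<dots> = (\<integral>\<^sup>+\<omega>. (\<integral>\<^sup>+t. ennreal (p * t powr (p - 1)) *
      (if 0 \<le> t \<and> t < Z \<omega> then 1 else 0) \<partial>lborel) \<partial>M)"
    by (intro nn_integral_cong) (auto simp: indicator_def)
  also have "\<dots> = (\<integral>\<^sup>+t. (\<integral>\<^sup>+\<omega>. ennreal (p * t powr (p - 1)) *
      (if 0 \<le> t \<and> t < Z \<omega> then 1 else 0) \<partial>M) \<partial>lborel)"
    by (rule L.Fubini'[symmetric]) measurable
  also have "\<dots> \<le> (\<integral>\<^sup>+t. ennreal (p * t powr (p - 1)) * indicator {0..} t
      * ennreal (exp (- l * t)) \<partial>lborel)"
  proof (intro nn_integral_mono)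
    fix t :: real
    have "(\<integral>\<^sup>+\<omega>. ennreal (p * t powr (p - 1)) * (if 0 \<le> t \<and> t < Z \<omega> then 1 else 0) \<partial>M)
      = ennreal (p * t powr (p - 1)) * indicator {0..} t * (\<integral>\<^sup>+\<omega>. indicator {\<omega>\<in>space M. Z \<omega> > t} \<omega> \<partial>M)"
      by (subst nn_integral_cmult[symmetric]) (auto intro!: nn_integral_cong simp: indicator_def)
    also have "\<dots> = ennreal (p * t powr (p - 1)) * indicator {0..} t * ennreal (prob {\<omega>\<in>space M. Z \<omega> > t})"
      by (simp add: emeasure_eq_measure)
    also have "\<dots> \<le> ennreal (p * t powr (p - 1)) * indicator {0..} t * ennreal (exp (- l * t))"
      using tail[of t] by (cases "0 \<le> t") (auto intro!: mult_left_mono ennreal_leI)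
    finally show "(\<integral>\<^sup>+\<omega>. ennreal (p * t powr (p - 1)) * (if 0 \<le> t \<and> t < Z \<omega> then 1 else 0) \<partial>M)
      \<le> ennreal (p * t powr (p - 1)) * indicator {0..} t * ennreal (exp (- l * t))" .
  qed
  also have "\<dots> = ennreal (Gamma (1 + p) * l powr (- p))"
    by (rule nn_integral_powr_times_exp) fact+
  finally show ?thesis .
qed

subsection \<open>Lower bound\<close>

text \<open>The function \<open>g\<close> may be negative, and \<open>ennreal\<close> truncates at
  \<open>0\<close>. So this is Jensen's inequality for the positive part.\<close>

lemma (in prob_space) expectation_le_nn_integral:
  fixes g :: "'a \<Rightarrow> real"
  assumes "integrable M g"
  shows "ennreal (expectation g) \<le> (\<integral>\<^sup>+\<omega>. ennreal (g \<omega>) \<partial>M)"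
proof -
  have max: "integrable M (\<lambda>\<omega>. max 0 (g \<omega>))"
    using assms by (intro integrable_max) auto
  have "ennreal (expectation g) \<le> ennreal (expectation (\<lambda>\<omega>. max 0 (g \<omega>)))"
    using assms max by (intro ennreal_leI integral_mono) auto
  also have "\<dots> = (\<integral>\<^sup>+\<omega>. ennreal (max 0 (g \<omega>)) \<partial>M)"
    using max by (intro nn_integral_eq_integral[symmetric]) auto
  also have "\<dots> = (\<integral>\<^sup>+\<omega>. ennreal (g \<omega>) \<partial>M)"
    by (intro nn_integral_cong) (auto simp: max_def ennreal_neg)
  finally show ?thesis .
qed

text \<open>Let \<open>S\<close> be the \<open>k\<close> indices attaining the sum. At least
  \<open>k\<close> minus the number of all \<open>i\<close> with \<open>Z i \<omega> \<le> t\<close>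
  of them have a value above \<open>t\<close>. The layer cake formula integrates this count over
  \<open>t\<close>; exchanging the integrals and averaging inside the positive part gives the
  claim.\<close>

lemma (in prob_space) nn_integral_sum_j_min_powr_ge:
  fixes Z :: "nat \<Rightarrow> 'a \<Rightarrow> real"
  assumes meas: "\<And>i. i \<in> {1..n} \<Longrightarrow> Z i \<in> borel_measurable M"
    and nonneg: "\<And>i \<omega>. i \<in> {1..n} \<Longrightarrow> 0 \<le> Z i \<omega>" and "k \<le> n" "0 < p"
  shows "(\<integral>\<^sup>+t. ennreal (p * t powr (p - 1)) * indicator {0..} t *
        ennreal (real k - (\<Sum>i=1..n. prob {\<omega>\<in>space M. Z i \<omega> \<le> t})) \<partial>lborel)
    \<le> (\<integral>\<^sup>+\<omega>. ennreal (\<Sum>j=1..k. j_min j n (\<lambda>i. Z i \<omega> powr p)) \<partial>M)"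
proof -
  interpret L: pair_sigma_finite M lborel ..
  define u where "u t = ennreal (p * t powr (p - 1)) * indicator {0..} t" for t
  define g where "g \<omega> t = real k - (\<Sum>i=1..n. if Z i \<omega> \<le> t then 1 else 0)" for \<omega> t
  have [measurable]: "u \<in> borel_measurable borel"
    unfolding u_def by measurable
  have g_meas: "(\<lambda>(\<omega>, t). g \<omega> t) \<in> borel_measurable (M \<Otimes>\<^sub>M lborel)"
  proof -
    have "(\<lambda>q. if Z i (fst q) \<le> snd q then 1 else 0 :: real) \<in> borel_measurable (M \<Otimes>\<^sub>M lborel)"
      if "i \<in> {1..n}" for i
    proof -
      note meas[OF that, measurable]
      show ?thesis
        by measurable
    qed
    then show ?thesis
      unfolding g_def split_beta' by (intro borel_measurable_diff borel_measurable_sum) auto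
  qed
  have pointwise: "(\<integral>\<^sup>+t. u t * ennreal (g \<omega> t) \<partial>lborel)
      \<le> ennreal (\<Sum>j=1..k. j_min j n (\<lambda>i. Z i \<omega> powr p))" for \<omega>
  proof -
    obtain S where S: "S \<subseteq> {1..n}" "card S = k"
      "(\<Sum>j=1..k. j_min j n (\<lambda>i. Z i \<omega> powr p)) = (\<Sum>i\<in>S. Z i \<omega> powr p)"
      by (rule sum_j_min_eq_sum_subset[OF \<open>k \<le> n\<close>])
    have le: "u t * ennreal (g \<omega> t) \<le>
        (\<Sum>i\<in>S. ennreal (p * t powr (p - 1)) * indicator {0..<Z i \<omega>} t)" for t
    proof (cases "0 \<le> t")
      case True
      have "(\<Sum>i\<in>S. if Z i \<omega> \<le> t then 1 else 0 :: real) \<le> (\<Sum>i=1..n. if Z i \<omega> \<le> t then 1 else 0)"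
        using S(1) by (intro sum_mono2) auto
      then have "g \<omega> t \<le> (\<Sum>i\<in>S. 1 - (if Z i \<omega> \<le> t then 1 else 0))"
        unfolding g_def sum_subtractf using S(2) by simp
      then have "ennreal (g \<omega> t) \<le> ennreal (\<Sum>i\<in>S. 1 - (if Z i \<omega> \<le> t then 1 else 0))"
        by (rule ennreal_leI)
      also have "\<dots> = (\<Sum>i\<in>S. ennreal (1 - (if Z i \<omega> \<le> t then 1 else 0)))"
        by (subst sum_ennreal) auto
      also have "\<dots> = (\<Sum>i\<in>S. indicator {0..<Z i \<omega>} t)"
        using True by (intro sum.cong) auto
      finally show ?thesis
        using True by (simp add: u_def mult_left_mono flip: sum_distrib_left)
    qed (simp add: u_def)
    have "(\<integral>\<^sup>+t. u t * ennreal (g \<omega> t) \<partial>lborel) \<le>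
        (\<integral>\<^sup>+t. (\<Sum>i\<in>S. ennreal (p * t powr (p - 1)) * indicator {0..<Z i \<omega>} t) \<partial>lborel)"
      by (intro nn_integral_mono le)
    also have "\<dots> = (\<Sum>i\<in>S. \<integral>\<^sup>+t. ennreal (p * t powr (p - 1)) * indicator {0..<Z i \<omega>} t \<partial>lborel)"
      by (intro nn_integral_sum) measurable
    also have "\<dots> = (\<Sum>i\<in>S. ennreal (Z i \<omega> powr p))"
      using S(1) nonneg \<open>0 < p\<close> by (intro sum.cong ennreal_powr_layer_cake[symmetric]) auto
    also have "\<dots> = ennreal (\<Sum>j=1..k. j_min j n (\<lambda>i. Z i \<omega> powr p))"
      unfolding S(3) by (subst sum_ennreal) auto
    finally show ?thesis .
  qed
  have "(\<integral>\<^sup>+t. u t * ennreal (real k - (\<Sum>i=1..n. prob {\<omega>\<in>space M. Z i \<omega> \<le> t})) \<partial>lborel)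
     \<le> (\<integral>\<^sup>+t. (\<integral>\<^sup>+\<omega>. u t * ennreal (g \<omega> t) \<partial>M) \<partial>lborel)"
  proof (rule nn_integral_mono)
    fix t :: real
    have int: "has_bochner_integral M (\<lambda>\<omega>. if Z i \<omega> \<le> t then 1 else 0 :: real)
        (prob {\<omega>\<in>space M. Z i \<omega> \<le> t})" if "i \<in> {1..n}" for i
    proof -
      have "{\<omega>\<in>space M. Z i \<omega> \<le> t} \<in> sets M"
        using meas[OF that] by measurable
      then have "has_bochner_integral M (indicator {\<omega>\<in>space M. Z i \<omega> \<le> t} :: 'a \<Rightarrow> real)
          (prob {\<omega>\<in>space M. Z i \<omega> \<le> t})"
        by (intro has_bochner_integral_real_indicator) (auto simp: emeasure_eq_measure)
      then show ?thesis
        by (rule has_bochner_integral_cong[THEN iffD1, rotated -1]) (auto simp: indicator_def)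
    qed
    have bint: "has_bochner_integral M (\<lambda>\<omega>. g \<omega> t) (real k - (\<Sum>i=1..n. prob {\<omega>\<in>space M. Z i \<omega> \<le> t}))"
      unfolding g_def using int
      by (intro has_bochner_integral_diff has_bochner_integral_sum)
        (auto simp: has_bochner_integral_iff prob_space)
    then have "u t * ennreal (real k - (\<Sum>i=1..n. prob {\<omega>\<in>space M. Z i \<omega> \<le> t}))
        \<le> u t * (\<integral>\<^sup>+\<omega>. ennreal (g \<omega> t) \<partial>M)"
      using expectation_le_nn_integral[of "\<lambda>\<omega>. g \<omega> t"]
      by (intro mult_left_mono) (auto simp: has_bochner_integral_iff)
    also have "\<dots> = (\<integral>\<^sup>+\<omega>. u t * ennreal (g \<omega> t) \<partial>M)"
      using bint by (intro nn_integral_cmult[symmetric]) (auto simp: has_bochner_integral_iff)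
    finally show "u t * ennreal (real k - (\<Sum>i=1..n. prob {\<omega>\<in>space M. Z i \<omega> \<le> t}))
        \<le> (\<integral>\<^sup>+\<omega>. u t * ennreal (g \<omega> t) \<partial>M)" .
  qed
  also have "\<dots> = (\<integral>\<^sup>+\<omega>. (\<integral>\<^sup>+t. u t * ennreal (g \<omega> t) \<partial>lborel) \<partial>M)"
    using g_meas by (intro L.Fubini') (simp add: split_beta')
  also have "\<dots> \<le> (\<integral>\<^sup>+\<omega>. ennreal (\<Sum>j=1..k. j_min j n (\<lambda>i. Z i \<omega> powr p)) \<partial>M)"
    by (intro nn_integral_mono pointwise)
  finally show ?thesis
    unfolding u_def .
qed

text \<open>With \<open>m\<close> the least element of \<open>J\<close>, the terms before
  \<open>m\<close> add up to at most \<open>m - 1\<close> and the others to at most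
  \<open>(k - m + 1) / 2\<close>. What remains of \<open>k\<close> is at least
  \<open>(k - m + 1) / 2\<close>, while \<open>J\<close> lies in \<open>{m..k}\<close>.\<close>

lemma half_card_le_diff_sum:
  fixes q w :: "nat \<Rightarrow> real"
  assumes q: "\<And>i. i \<in> {1..n} \<Longrightarrow> q i \<le> 1" "\<And>i. i \<in> {1..n} \<Longrightarrow> q i \<le> T * w i"
    and "k \<le> n" and J: "J = {j\<in>{1..k}. 2 * T * (\<Sum>i=j..n. w i) < real k - real j + 1}" "J \<noteq> {}"
  shows "real (card J) / 2 \<le> real k - (\<Sum>i=1..n. q i)"
proof -
  define m where "m = Min J"
  have "finite J"
    using J by simp
  then have m: "m \<in> J" and "\<And>j. j \<in> J \<Longrightarrow> m \<le> j"
    using J(2) by (auto simp: m_def intro: Min_in)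
  then have "J \<subseteq> {m..k}"
    unfolding J(1) by auto
  then have "card J \<le> k + 1 - m"
    using card_mono[of "{m..k}" J] by simp
  moreover have "1 \<le> m" "m \<le> k" and T: "2 * T * (\<Sum>i=m..n. w i) < real k - real m + 1"
    using m J by auto
  moreover have "{1..n} = {1..<m} \<union> {m..n}"
    using \<open>1 \<le> m\<close> \<open>m \<le> k\<close> \<open>k \<le> n\<close> by auto
  then have "(\<Sum>i=1..n. q i) = (\<Sum>i=1..<m. q i) + (\<Sum>i=m..n. q i)"
    by (simp only:) (intro sum.union_disjoint; auto)
  moreover have "(\<Sum>i=1..<m. q i) \<le> (\<Sum>i=1..<m. 1)"
    using q(1) \<open>m \<le> k\<close> \<open>k \<le> n\<close> by (intro sum_mono) auto
  moreover have "(\<Sum>i=m..n. q i) \<le> (\<Sum>i=m..n. T * w i)"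
    using q(2) \<open>1 \<le> m\<close> by (intro sum_mono) auto
  ultimately show ?thesis
    by (simp add: of_nat_diff flip: sum_distrib_left)
qed

lemma (in prob_space) nn_integral_sum_j_min_powr_ge_of_small_ball:
  fixes Z :: "nat \<Rightarrow> 'a \<Rightarrow> real" and w :: "nat \<Rightarrow> real"
  assumes meas: "\<And>i. i \<in> {1..n} \<Longrightarrow> Z i \<in> borel_measurable M"
    and nonneg: "\<And>i \<omega>. i \<in> {1..n} \<Longrightarrow> 0 \<le> Z i \<omega>" and "k \<le> n" "0 < p" "0 < \<alpha>"
    and w: "\<And>i. i \<in> {1..n} \<Longrightarrow> 0 < w i"
    and small: "\<And>i t. i \<in> {1..n} \<Longrightarrow> 0 \<le> t \<Longrightarrow> prob {\<omega>\<in>space M. Z i \<omega> \<le> t} \<le> \<alpha> * t * w i"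
  shows "ennreal (1 / 2 * (\<Sum>j=1..k. ((real k - real j + 1) / (2 * \<alpha> * (\<Sum>i=j..n. w i))) powr p))
    \<le> (\<integral>\<^sup>+\<omega>. ennreal (\<Sum>j=1..k. j_min j n (\<lambda>i. Z i \<omega> powr p)) \<partial>M)"
proof -
  \<comment> \<open>The time at which \<open>j\<close> drops out of the set \<open>J\<close> of
    \<open>half_card_le_diff_sum\<close> with \<open>T = \<alpha> * t\<close>: \<open>j\<close>
    belongs to \<open>J\<close> exactly when \<open>t < c j\<close>. By the layer cake formula the
    sum of the \<open>c j powr p\<close> is therefore the weighted integral of
    \<open>card J\<close>.\<close>
  define c where "c j = (real k - real j + 1) / (2 * \<alpha> * (\<Sum>i=j..n. w i))" for j
  define u where "u t = ennreal (p * t powr (p - 1))" for t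
  have [measurable]: "u \<in> borel_measurable borel"
    unfolding u_def by measurable
  have b_pos: "0 < (\<Sum>i=j..n. w i)" if "j \<in> {1..k}" for j
    using that w \<open>k \<le> n\<close> by (intro sum_pos) auto
  then have c_nonneg: "0 \<le> c j" if "j \<in> {1..k}" for j
    using that \<open>0 < \<alpha>\<close> by (auto simp: c_def less_imp_le intro!: divide_nonneg_nonneg)
  have "ennreal (1 / 2 * (\<Sum>j=1..k. c j powr p)) = ennreal (1 / 2) * ennreal (\<Sum>j=1..k. c j powr p)"
    by (rule ennreal_mult) (auto intro: sum_nonneg)
  also have "ennreal (\<Sum>j=1..k. c j powr p) = (\<Sum>j=1..k. ennreal (c j powr p))"
    by (rule sum_ennreal[symmetric]) simp
  also have "ennreal (1 / 2) * \<dots> = ennreal (1 / 2) * (\<Sum>j=1..k. \<integral>\<^sup>+t. u t * indicator {0..<c j} t \<partial>lborel)"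
    unfolding u_def using c_nonneg \<open>0 < p\<close>
    by (intro arg_cong2[where f = "(*)"] sum.cong ennreal_powr_layer_cake refl) auto
  also have "\<dots> = (\<integral>\<^sup>+t. ennreal (1 / 2) * (\<Sum>j=1..k. u t * indicator {0..<c j} t) \<partial>lborel)"
    by (subst nn_integral_cmult, measurable) (subst nn_integral_sum, auto)
  also have "\<dots> \<le> (\<integral>\<^sup>+t. u t * indicator {0..} t *
        ennreal (real k - (\<Sum>i=1..n. prob {\<omega>\<in>space M. Z i \<omega> \<le> t})) \<partial>lborel)"
  proof (rule nn_integral_mono)
    fix t :: real
    define J where "J = {j\<in>{1..k}. 2 * (\<alpha> * t) * (\<Sum>i=j..n. w i) < real k - real j + 1}"
    show "ennreal (1 / 2) * (\<Sum>j=1..k. u t * indicator {0..<c j} t) \<le> u t * indicator {0..} t *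
        ennreal (real k - (\<Sum>i=1..n. prob {\<omega>\<in>space M. Z i \<omega> \<le> t}))"
    proof (cases "0 \<le> t")
      case True
      have "{1..k} \<inter> J = J"
        by (auto simp: J_def)
      then have card: "(\<Sum>j=1..k. indicator J j :: ennreal) = of_nat (card J)"
        by (simp add: indicator_def of_bool_def sum.If_cases)
      have "t < c j \<longleftrightarrow> j \<in> J" if "j \<in> {1..k}" for j
        using b_pos[OF that] that \<open>0 < \<alpha>\<close> by (simp add: c_def J_def pos_less_divide_eq mult_ac)
      then have "(\<Sum>j=1..k. indicator {0..<c j} t) = (\<Sum>j=1..k. indicator J j :: ennreal)"
        using True by (intro sum.cong) (auto simp: indicator_def)
      also have "\<dots> = ennreal (card J)"
        unfolding card by (simp add: ennreal_of_nat_eq_real_of_nat)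
      finally have count: "(\<Sum>j=1..k. indicator {0..<c j} t) = ennreal (card J)" .
      have "ennreal (1 / 2) * (\<Sum>j=1..k. u t * indicator {0..<c j} t)
          = u t * (ennreal (1 / 2) * ennreal (card J))"
        unfolding sum_distrib_left[symmetric] count by (rule mult.left_commute)
      also have "ennreal (1 / 2) * ennreal (card J) = ennreal (card J / 2)"
        by (subst ennreal_mult[symmetric]) auto
      finally have eq: "ennreal (1 / 2) * (\<Sum>j=1..k. u t * indicator {0..<c j} t)
          = u t * ennreal (card J / 2)" .
      have "ennreal (card J / 2) \<le> ennreal (real k - (\<Sum>i=1..n. prob {\<omega>\<in>space M. Z i \<omega> \<le> t}))"
      \<comment> \<open>For empty \<open>J\<close> the difference on the right may be negative, but
        then both sides are compared after truncation and the left one is \<open>0\<close>.\<close>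
      proof (cases "J = {}")
        case False
        then show ?thesis
          using small True \<open>k \<le> n\<close> by (intro ennreal_leI half_card_le_diff_sum[OF _ _ _ J_def]) auto
      qed simp
      then show ?thesis
        unfolding eq using True by (simp add: mult_left_mono)
    qed simp
  qed
  also have "\<dots> \<le> (\<integral>\<^sup>+\<omega>. ennreal (\<Sum>j=1..k. j_min j n (\<lambda>i. Z i \<omega> powr p)) \<partial>M)"
    unfolding u_def by (intro nn_integral_sum_j_min_powr_ge meas nonneg \<open>k \<le> n\<close> \<open>0 < p\<close>)
  finally show ?thesis
    unfolding c_def .
qed

subsection \<open>Disjoint groups of large weight\<close>

text \<open>Greedy choice: each index of \<open>J\<close> takes a group whose weight lies between
  \<theta> and \<open>2 * \<theta>\<close>. Removing it lowers the total by at most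
  \<open>2 * \<theta>\<close>, so enough weight is left for the other indices.\<close>

lemma exists_disjoint_subsets_sum_ge:
  fixes w :: "'a \<Rightarrow> real"
  assumes "finite J" "finite S" "\<theta> > 0" "\<And>i. i \<in> S \<Longrightarrow> w i \<le> 2 * \<theta>"
    and "2 * \<theta> * card J \<le> sum w S"
  shows "\<exists>A. disjoint_family_on A J \<and> (\<forall>r\<in>J. A r \<subseteq> S \<and> \<theta> \<le> sum w (A r))"
  using assms(1,2,4,5)
proof (induction J arbitrary: S rule: finite_induct)
  case empty
  show ?case
    by (simp add: disjoint_family_on_def)
next
  case (insert r J)
  define P where "P B \<longleftrightarrow> B \<subseteq> S \<and> \<theta> \<le> sum w B" for B
  have "1 \<le> real (card (insert r J))"
    using insert.hyps by simp
  then have "2 * \<theta> * 1 \<le> 2 * \<theta> * card (insert r J)"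
    using \<open>\<theta> > 0\<close> by (intro mult_left_mono) auto
  then have "\<theta> \<le> sum w S"
    using insert.prems(3) \<open>\<theta> > 0\<close> by linarith
  then have "P S"
    by (simp add: P_def)
  then obtain B where B: "P B" and min: "\<And>C. P C \<Longrightarrow> card B \<le> card C"
    using ex_has_least_nat[of P S card] by metis
  have fin: "finite B"
    using B insert.prems(1) finite_subset unfolding P_def by blast
  have small: "sum w C < \<theta>" if "C \<subset> B" for C
  proof (rule ccontr)
    assume "\<not> sum w C < \<theta>"
    then have "P C"
      using that B by (auto simp: P_def)
    then show False
      using min[of C] psubset_card_mono[OF fin that] by simp
  qed
  \<comment> \<open>A \<open>B\<close> of least cardinality is a singleton, or splits into two parts of weight less than \<open>\<theta>\<close>.\<close>
  have upper: "sum w B \<le> 2 * \<theta>"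
  proof -
    obtain i where i: "i \<in> B"
      using B \<open>\<theta> > 0\<close> unfolding P_def by (metis ex_in_conv not_less sum.empty)
    show ?thesis
    proof (cases "B = {i}")
      case True
      then show ?thesis
        using B insert.prems(2) by (simp add: P_def)
    next
      case False
      then have "sum w (B - {i}) < \<theta>" "sum w {i} < \<theta>"
        using i small[of "B - {i}"] small[of "{i}"] by blast+
      then show ?thesis
        using sum.remove[OF fin i, of w] by simp
    qed
  qed
  have "sum w S = sum w (S - B) + sum w B"
    using B insert.prems(1) by (intro sum.subset_diff) (auto simp: P_def)
  then have "2 * \<theta> * card J \<le> sum w (S - B)"
    using upper insert.prems(3) insert.hyps by (simp add: algebra_simps)
  then obtain A where A: "disjoint_family_on A J" "\<forall>s\<in>J. A s \<subseteq> S - B \<and> \<theta> \<le> sum w (A s)"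
    using insert.IH[of "S - B"] insert.prems(1,2) by auto
  have "disjoint_family_on (A(r := B)) (insert r J)"
    using A insert.hyps(2) unfolding disjoint_family_on_def by (auto split: if_splits)
  moreover have "\<forall>s\<in>insert r J. (A(r := B)) s \<subseteq> S \<and> \<theta> \<le> sum w ((A(r := B)) s)"
    using A B insert.hyps(2) by (auto simp: P_def)
  ultimately show ?case
    by blast
qed

text \<open>Only the first half of \<open>{m..k}\<close> is used, where \<open>k - j + 1\<close> is
  at least half of \<open>k - m + 1\<close>. Dropping the other half costs the factor
  \<open>2\<close>; passing from \<open>K / (2 * B)\<close> to \<open>2 * K / B\<close> costs
  \<open>4 powr p\<close>.\<close>

lemma card_times_powr_le_sum_powr:
  fixes b :: "nat \<Rightarrow> real"
  assumes "m \<le> k" "0 < p" "\<And>j. j \<in> {m..k} \<Longrightarrow> 0 < b j \<and> b j \<le> B"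
  shows "real (k - m + 1) * (2 * real (k - m + 1) / B) powr p
    \<le> 2 * 4 powr p * (\<Sum>j=m..k. ((real k - real j + 1) / b j) powr p)"
proof -
  define K where "K = k - m + 1"
  have "0 < B"
    using assms(1) assms(3)[of m] by force
  \<comment> \<open>This has \<open>K / 2\<close> elements rounded up, and even its last element
    satisfies \<open>k - j + 1 \<ge> K / 2\<close>.\<close>
  define J where "J = {m..m + (K - 1) div 2}"
  have J: "J \<subseteq> {m..k}" and card: "real K / 2 \<le> card J"
    using assms(1) by (auto simp: J_def K_def)
  have "(real K / (2 * B)) powr p \<le> ((real k - real j + 1) / b j) powr p" if "j \<in> J" for j
  proof -
    have "real K / 2 \<le> real k - real j + 1"
      using that assms(1) by (auto simp: J_def K_def)
    moreover have "0 < b j" "b j \<le> B"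
      using that J assms(3) by auto
    ultimately have "real K / 2 / B \<le> (real k - real j + 1) / b j"
      by (intro frac_le) auto
    then show ?thesis
      using \<open>0 < B\<close> \<open>0 < p\<close> by (intro powr_mono2) auto
  qed
  then have "card J * (real K / (2 * B)) powr p \<le> (\<Sum>j\<in>J. ((real k - real j + 1) / b j) powr p)"
    by (rule sum_bounded_below)
  also have "\<dots> \<le> (\<Sum>j=m..k. ((real k - real j + 1) / b j) powr p)"
    using J by (intro sum_mono2) auto
  finally have "real K / 2 * (real K / (2 * B)) powr p \<le> (\<Sum>j=m..k. ((real k - real j + 1) / b j) powr p)"
    using mult_right_mono[OF card, of "(real K / (2 * B)) powr p"] by simp
  moreover have "(2 * real K / B) powr p = 4 powr p * (real K / (2 * B)) powr p"
    using \<open>0 < B\<close> by (simp flip: powr_mult)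
  ultimately show ?thesis
    unfolding K_def[symmetric] by (simp add: mult_left_mono)
qed

text \<open>The two regimes give the two summands of the constant: singletons below \<open>m\<close>
  cost at most their own term of the sum, hence the \<open>1\<close>; the groups of equal guaranteed
  weight from \<open>m\<close> on are handled by \<open>card_times_powr_le_sum_powr\<close>, hence
  \<open>2 * 4 powr p\<close>.\<close>

lemma exists_disjoint_groups:
  fixes w b :: "nat \<Rightarrow> real"
  assumes "0 < p" "1 \<le> k" "k \<le> n" and w: "\<And>i. i \<in> {1..n} \<Longrightarrow> 0 < w i"
    and mono: "\<And>i j. 1 \<le> i \<Longrightarrow> i \<le> j \<Longrightarrow> j \<le> n \<Longrightarrow> w j \<le> w i"
    and b: "\<And>j. j \<in> {1..n} \<Longrightarrow> b j = (\<Sum>i=j..n. w i)"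
  shows "\<exists>A. disjoint_family_on A {1..k} \<and> (\<forall>r\<in>{1..k}. A r \<noteq> {} \<and> A r \<subseteq> {1..n}) \<and>
    (\<Sum>r=1..k. sum w (A r) powr (- p))
      \<le> (1 + 2 * 4 powr p) * (\<Sum>j=1..k. ((real k - real j + 1) / b j) powr p)"
proof -
  define f where "f j = ((real k - real j + 1) / b j) powr p" for j
  define Q where "Q j \<longleftrightarrow> 1 \<le> j \<and> j \<le> k \<and> w j * (real k - real j + 1) \<le> b j" for j
  define m where "m = (LEAST j. Q j)"
  have b_pos: "0 < b j" if "j \<in> {1..n}" for j
    unfolding b[OF that] using that w by (intro sum_pos) auto
  have b_ge: "w j \<le> b j" if "j \<in> {1..n}" for j
    unfolding b[OF that] using that w by (intro member_le_sum) (auto intro: less_imp_le)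
  \<comment> \<open>At \<open>j = k\<close> the factor is \<open>1\<close>, and \<open>w k\<close>
    is one of the terms of \<open>b k\<close>. So the least index exists and is at most
    \<open>k\<close>.\<close>
  have "Q k"
    using assms(2,3) b_ge[of k] by (simp add: Q_def)
  then have "Q m" and least: "\<And>j. j < m \<Longrightarrow> \<not> Q j"
    unfolding m_def by (auto intro: LeastI dest: not_less_Least)
  then have m: "1 \<le> m" "m \<le> k" "w m * (real k - real m + 1) \<le> b m"
    by (auto simp: Q_def)
  define K where "K = k - m + 1"
  \<comment> \<open>Chosen so that \<open>2 * \<theta> * K\<close> is the whole weight
    \<open>b m\<close> of \<open>{m..n}\<close>; the defining property of \<open>m\<close> then
    reads \<open>w m \<le> 2 * \<theta>\<close>.\<close>
  define \<theta> where "\<theta> = b m / (2 * K)"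
  have K: "0 < K" "real K = real k - real m + 1" "card {m..k} = K"
    using m(2) by (auto simp: K_def)
  have bm: "0 < b m" "b m = (\<Sum>i=m..n. w i)"
    using m(1,2) assms(3) b_pos[of m] b[of m] by auto
  have "0 < \<theta>"
    using K bm by (simp add: \<theta>_def)
  have "w m \<le> 2 * \<theta>"
    using m(3) K(1) unfolding K(2)[symmetric] by (simp add: \<theta>_def field_simps)
  then have "w i \<le> 2 * \<theta>" if "i \<in> {m..n}" for i
    using mono[of m i] that m(1) by auto
  moreover have "2 * \<theta> * card {m..k} \<le> (\<Sum>i=m..n. w i)"
    using K(1) bm(2) unfolding K(3) by (simp add: \<theta>_def)
  ultimately have "\<exists>A. disjoint_family_on A {m..k} \<and> (\<forall>r\<in>{m..k}. A r \<subseteq> {m..n} \<and> \<theta> \<le> sum w (A r))"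
    using \<open>0 < \<theta>\<close> by (intro exists_disjoint_subsets_sum_ge) auto
  then obtain A where A: "disjoint_family_on A {m..k}" "\<And>r. r \<in> {m..k} \<Longrightarrow> A r \<subseteq> {m..n}"
      "\<And>r. r \<in> {m..k} \<Longrightarrow> \<theta> \<le> sum w (A r)"
    by blast
  define C where "C r = (if r < m then {r} else A r)" for r
  have "C r \<inter> C s = {}" if "r \<in> {1..k}" "s \<in> {1..k}" "r \<noteq> s" for r s
  proof -
    have "A r \<inter> A s = {}" if "m \<le> r" "m \<le> s"
      using disjoint_family_onD[OF A(1)] that \<open>r \<in> _\<close> \<open>s \<in> _\<close> \<open>r \<noteq> s\<close> by auto
    then show ?thesis
      using that A(2)[of r] A(2)[of s] by (force simp: C_def)
  qed
  then have disj: "disjoint_family_on C {1..k}"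
    by (simp add: disjoint_family_on_def)
  have sub: "C r \<noteq> {} \<and> C r \<subseteq> {1..n}" if "r \<in> {1..k}" for r
  proof (cases "r < m")
    case False
    \<comment> \<open>A group of weight at least \<theta> cannot be empty, since \<theta> is
      positive.\<close>
    then have "A r \<subseteq> {m..n}" "\<theta> \<le> sum w (A r)"
      using A(2,3) that by auto
    then show ?thesis
      using False \<open>0 < \<theta>\<close> m(1) by (auto simp: C_def)
  qed (use that assms(3) in \<open>auto simp: C_def\<close>)
  have "(\<Sum>r=1..<m. sum w (C r) powr (- p)) \<le> (\<Sum>r=1..<m. f r)"
  proof (rule sum_mono)
    fix r assume r: "r \<in> {1..<m}"
    then have r': "r \<in> {1..n}" "real k - real r + 1 > 0"
      using m(2) assms(3) by auto
    have "b r < w r * (real k - real r + 1)"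
      using least[of r] r m(2) by (auto simp: Q_def)
    then have "1 / w r \<le> (real k - real r + 1) / b r"
      using w[OF r'(1)] b_pos[OF r'(1)] by (simp add: field_simps)
    then have "(1 / w r) powr p \<le> f r"
      unfolding f_def using w[OF r'(1)] assms(1) by (intro powr_mono2) auto
    then show "sum w (C r) powr (- p) \<le> f r"
      using r w[OF r'(1)] by (simp add: C_def powr_minus powr_divide inverse_eq_divide)
  qed
  also have "\<dots> \<le> (\<Sum>r=1..k. f r)"
    using m(2) by (intro sum_mono2) (auto simp: f_def)
  finally have small: "(\<Sum>r=1..<m. sum w (C r) powr (- p)) \<le> (\<Sum>r=1..k. f r)" .
  have "(\<Sum>r=m..k. sum w (C r) powr (- p)) \<le> (\<Sum>r=m..k. \<theta> powr (- p))"
    using A(3) \<open>0 < \<theta>\<close> assms(1) by (intro sum_mono) (auto simp: C_def intro!: powr_mono2')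
  also have "\<dots> = real K * (2 * real K / b m) powr p"
    using K bm by (simp add: \<theta>_def powr_minus powr_divide)
  also have "\<dots> \<le> 2 * 4 powr p * (\<Sum>r=m..k. f r)"
  proof -
    have "b j \<le> b m" if "j \<in> {m..k}" for j
    proof -
      have "(\<Sum>i=j..n. w i) \<le> (\<Sum>i=m..n. w i)"
        using that m(1) w by (intro sum_mono2) (auto intro: less_imp_le)
      then show ?thesis
        using b[of j] b[of m] that m assms(3) by auto
    qed
    then show ?thesis
      unfolding f_def K_def using m assms(1,3) b_pos by (intro card_times_powr_le_sum_powr) auto
  qed
  also have "\<dots> \<le> 2 * 4 powr p * (\<Sum>r=1..k. f r)"
    using m(1) by (intro mult_left_mono sum_mono2) (auto simp: f_def)
  finally have large: "(\<Sum>r=m..k. sum w (C r) powr (- p)) \<le> 2 * 4 powr p * (\<Sum>r=1..k. f r)" .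
  have "{1..k} = {1..<m} \<union> {m..k}"
    using m by auto
  then have "(\<Sum>r=1..k. sum w (C r) powr (- p))
      = (\<Sum>r=1..<m. sum w (C r) powr (- p)) + (\<Sum>r=m..k. sum w (C r) powr (- p))"
    by (simp only:) (intro sum.union_disjoint; auto)
  also have "\<dots> \<le> (1 + 2 * 4 powr p) * (\<Sum>r=1..k. f r)"
    using small large by (simp add: algebra_simps)
  finally show ?thesis
    using disj sub unfolding f_def by blast
qed

subsection \<open>Upper bound\<close>

lemma (in prob_space) prob_Min_gt:
  fixes Z :: "'i \<Rightarrow> 'a \<Rightarrow> real"
  assumes "indep_vars (\<lambda>_. borel) Z I" "A \<subseteq> I" "A \<noteq> {}" "finite A"
  shows "prob {\<omega>\<in>space M. Min ((\<lambda>i. Z i \<omega>) ` A) > t} = (\<Prod>i\<in>A. prob {\<omega>\<in>space M. Z i \<omega> > t})"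
proof -
  have "{\<omega>\<in>space M. Min ((\<lambda>i. Z i \<omega>) ` A) > t} = (\<Inter>i\<in>A. Z i -` {t<..} \<inter> space M)"
    using assms(3,4) by auto
  also have "prob \<dots> = (\<Prod>i\<in>A. prob (Z i -` {t<..} \<inter> space M))"
    using assms by (intro indep_varsD) auto
  also have "\<dots> = (\<Prod>i\<in>A. prob {\<omega>\<in>space M. Z i \<omega> > t})"
    by (intro prod.cong arg_cong[where f = prob]) auto
  finally show ?thesis .
qed

text \<open>By independence the tail of the minimum is the product of the tails, so the exponential
  rates add up to \<open>sum l A\<close>.\<close>

lemma (in prob_space) nn_integral_Min_powr_le:
  fixes Z :: "'i \<Rightarrow> 'a \<Rightarrow> real" and l :: "'i \<Rightarrow> real"
  assumes indep: "indep_vars (\<lambda>_. borel) Z I" and A: "A \<subseteq> I" "A \<noteq> {}" "finite A"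
    and "0 < p" "\<And>i. i \<in> A \<Longrightarrow> 0 < l i" and nonneg: "\<And>i \<omega>. i \<in> A \<Longrightarrow> 0 \<le> Z i \<omega>"
    and tail: "\<And>i t. i \<in> A \<Longrightarrow> 0 \<le> t \<Longrightarrow> prob {\<omega>\<in>space M. Z i \<omega> > t} \<le> exp (- l i * t)"
  shows "(\<integral>\<^sup>+\<omega>. ennreal (Min ((\<lambda>i. Z i \<omega>) ` A) powr p) \<partial>M) \<le> ennreal (Gamma (1 + p) * sum l A powr (- p))"
proof (rule nn_integral_powr_le_of_exp_tail)
  show "(\<lambda>\<omega>. Min ((\<lambda>i. Z i \<omega>) ` A)) \<in> borel_measurable M"
    using A indep_vars_def2[THEN iffD1, OF indep] by (intro borel_measurable_Min) auto
  show "0 < sum l A"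
    using assms by (intro sum_pos) auto
  show "0 \<le> Min ((\<lambda>i. Z i \<omega>) ` A)" for \<omega>
    using A nonneg by simp
  fix t :: real assume "0 \<le> t"
  have "(\<Prod>i\<in>A. prob {\<omega>\<in>space M. Z i \<omega> > t}) \<le> (\<Prod>i\<in>A. exp (- l i * t))"
    using tail \<open>0 \<le> t\<close> by (intro prod_mono) auto
  also have "\<dots> = exp (- sum l A * t)"
    using A by (simp add: exp_sum[symmetric] sum_distrib_right sum_negf)
  finally show "prob {\<omega>\<in>space M. Min ((\<lambda>i. Z i \<omega>) ` A) > t} \<le> exp (- sum l A * t)"
    using prob_Min_gt[OF indep A] by simp
qed fact

lemma Min_powr:
  fixes f :: "'i \<Rightarrow> real"
  assumes "finite A" "A \<noteq> {}" "0 \<le> p" "\<And>i. i \<in> A \<Longrightarrow> 0 \<le> f i"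
  shows "Min ((\<lambda>i. f i powr p) ` A) = Min (f ` A) powr p"
proof (rule Min_eqI)
  have "Min (f ` A) \<in> f ` A"
    using assms by (intro Min_in) auto
  then show "Min (f ` A) powr p \<in> (\<lambda>i. f i powr p) ` A"
    by auto
  show "Min (f ` A) powr p \<le> y" if y: "y \<in> (\<lambda>i. f i powr p) ` A" for y
  proof -
    have "0 \<le> Min (f ` A)"
      using assms by simp
    moreover obtain i where "i \<in> A" "y = f i powr p"
      using y by auto
    ultimately show ?thesis
      using assms(1) by (simp add: powr_mono2[OF assms(3)])
  qed
qed (use assms in auto)

text \<open>The minimum over the group \<open>A r\<close> has an exponential tail of rate
  \<open>\<beta> * sum w (A r)\<close>. Its moment bound supplies the factors
  \<open>\<beta> powr (- p)\<close> and \<open>Gamma (1 + p)\<close> of \<open>W\<close>; the choice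
  of groups supplies the last one.\<close>

lemma (in prob_space) nn_integral_sum_j_min_powr_le_of_exp_tail:
  fixes Z :: "nat \<Rightarrow> 'a \<Rightarrow> real" and w :: "nat \<Rightarrow> real"
  assumes indep: "indep_vars (\<lambda>_. borel) Z {1..n}"
    and nonneg: "\<And>i \<omega>. i \<in> {1..n} \<Longrightarrow> 0 \<le> Z i \<omega>" and "1 \<le> k" "k \<le> n" "0 < p" "0 < \<beta>"
    and w: "\<And>i. i \<in> {1..n} \<Longrightarrow> 0 < w i"
    and mono: "\<And>i j. 1 \<le> i \<Longrightarrow> i \<le> j \<Longrightarrow> j \<le> n \<Longrightarrow> w j \<le> w i"
    and tail: "\<And>i t. i \<in> {1..n} \<Longrightarrow> 0 \<le> t \<Longrightarrow> prob {\<omega>\<in>space M. Z i \<omega> > t} \<le> exp (- (\<beta> * w i) * t)"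
  shows "(\<integral>\<^sup>+\<omega>. ennreal (\<Sum>j=1..k. j_min j n (\<lambda>i. Z i \<omega> powr p)) \<partial>M)
    \<le> ennreal (W \<beta> p * (\<Sum>j=1..k. ((real k - real j + 1) / (\<Sum>i=j..n. w i)) powr p))"
proof -
  obtain A where disj: "disjoint_family_on A {1..k}"
    and A: "\<And>r. r \<in> {1..k} \<Longrightarrow> A r \<noteq> {} \<and> A r \<subseteq> {1..n}"
    and le: "(\<Sum>r=1..k. sum w (A r) powr (- p)) \<le> (1 + 2 * 4 powr p) *
        (\<Sum>j=1..k. ((real k - real j + 1) / (\<Sum>i=j..n. w i)) powr p)"
    using exists_disjoint_groups[where w = w and b = "\<lambda>j. \<Sum>i=j..n. w i",
        OF \<open>0 < p\<close> \<open>1 \<le> k\<close> \<open>k \<le> n\<close> w mono refl] by blast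
  have fin: "finite (A r)" if "r \<in> {1..k}" for r
    using A[OF that] finite_subset by blast
  have meas: "\<And>i. i \<in> {1..n} \<Longrightarrow> Z i \<in> borel_measurable M"
    using indep by (simp add: indep_vars_def2)
  have Gamma: "0 < Gamma (1 + p)"
    using \<open>0 < p\<close> by (intro Gamma_real_pos) simp
  have "(\<integral>\<^sup>+\<omega>. ennreal (\<Sum>j=1..k. j_min j n (\<lambda>i. Z i \<omega> powr p)) \<partial>M)
      \<le> (\<integral>\<^sup>+\<omega>. (\<Sum>r=1..k. ennreal (Min ((\<lambda>i. Z i \<omega>) ` A r) powr p)) \<partial>M)"
  proof (rule nn_integral_mono)
    fix \<omega>
    have "(\<Sum>j=1..k. j_min j n (\<lambda>i. Z i \<omega> powr p)) \<le> (\<Sum>r=1..k. Min ((\<lambda>i. Z i \<omega> powr p) ` A r))"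
      by (rule sum_j_min_le_sum_Min[OF disj A])
    also have "\<dots> = (\<Sum>r=1..k. Min ((\<lambda>i. Z i \<omega>) ` A r) powr p)"
      using A fin nonneg \<open>0 < p\<close> by (intro sum.cong Min_powr) (auto simp: subset_iff)
    finally show "ennreal (\<Sum>j=1..k. j_min j n (\<lambda>i. Z i \<omega> powr p))
        \<le> (\<Sum>r=1..k. ennreal (Min ((\<lambda>i. Z i \<omega>) ` A r) powr p))"
      by (subst sum_ennreal) (auto intro: ennreal_leI)
  qed
  also have "\<dots> = (\<Sum>r=1..k. \<integral>\<^sup>+\<omega>. ennreal (Min ((\<lambda>i. Z i \<omega>) ` A r) powr p) \<partial>M)"
  proof (rule nn_integral_sum)
    fix r assume r: "r \<in> {1..k}"
    have [measurable]: "(\<lambda>\<omega>. Min ((\<lambda>i. Z i \<omega>) ` A r)) \<in> borel_measurable M"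
      using meas A[OF r] fin[OF r] by (intro borel_measurable_Min) auto
    show "(\<lambda>\<omega>. ennreal (Min ((\<lambda>i. Z i \<omega>) ` A r) powr p)) \<in> borel_measurable M"
      by measurable
  qed
  also have "\<dots> \<le> (\<Sum>r=1..k. ennreal (Gamma (1 + p) * (\<Sum>i\<in>A r. \<beta> * w i) powr (- p)))"
  proof (rule sum_mono)
    fix r assume r: "r \<in> {1..k}"
    show "(\<integral>\<^sup>+\<omega>. ennreal (Min ((\<lambda>i. Z i \<omega>) ` A r) powr p) \<partial>M)
        \<le> ennreal (Gamma (1 + p) * (\<Sum>i\<in>A r. \<beta> * w i) powr (- p))"
      using A[OF r] fin[OF r] \<open>0 < p\<close> \<open>0 < \<beta>\<close> w nonneg tail
      by (intro nn_integral_Min_powr_le[OF indep]) (auto simp: subset_iff)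
  qed
  also have "\<dots> = ennreal (\<beta> powr (- p) * Gamma (1 + p) * (\<Sum>r=1..k. sum w (A r) powr (- p)))"
    using \<open>0 < \<beta>\<close> Gamma w A
    by (subst sum_ennreal)
      (auto simp: powr_mult mult_ac sum_distrib_left[symmetric] subset_iff less_imp_le
        intro!: sum_nonneg)
  also have "\<dots> \<le> ennreal (W \<beta> p * (\<Sum>j=1..k. ((real k - real j + 1) / (\<Sum>i=j..n. w i)) powr p))"
    using mult_left_mono[OF le, of "\<beta> powr (- p) * Gamma (1 + p)"] Gamma
    by (intro ennreal_leI) (simp add: W_def mult_ac)
  finally show ?thesis .
qed

section \<open>Rescaling by the \<open>x i\<close> and passing to real expectations\<close>

theorem theorem5p1:
  fixes M :: "'a measure" and \<xi> :: "nat \<Rightarrow> 'a \<Rightarrow> real"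
    and x b :: "nat \<Rightarrow> real" and p \<alpha> \<beta> :: real and n k :: nat
  assumes "prob_space M"
    and "p > 0" and "\<alpha> > 0" and "\<beta> > 0"
    and "prob_space.indep_vars M (\<lambda>_. borel) \<xi> {1..n}"
    and "\<And>i. i \<in> {1..n} \<Longrightarrow> alpha_beta_condition M \<alpha> \<beta> (\<xi> i)"
    and "\<And>i. i \<in> {1..n} \<Longrightarrow> 0 < x i"
    and "mono_on {1..n} x"
    and "\<And>j. j \<in> {1..n} \<Longrightarrow> b j = (\<Sum>i=j..n. 1 / x i)"
    and "1 \<le> k" and "k \<le> n"
  shows "1 / 2 * (1 / (16 * \<alpha>)) powr p * (\<Sum>j=1..k. (real k - real j + 1) powr p / b j powr p)
           \<le> (\<integral>\<omega>. (\<Sum>j=1..k. j_min j n (\<lambda>i. \<bar>x i * \<xi> i \<omega>\<bar> powr p)) \<partial>M) \<and>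
         (\<integral>\<omega>. (\<Sum>j=1..k. j_min j n (\<lambda>i. \<bar>x i * \<xi> i \<omega>\<bar> powr p)) \<partial>M)
           \<le> W \<beta> p * (\<Sum>j=1..k. (real k - real j + 1) powr p / b j powr p)"
proof -
  interpret prob_space M by fact
  define Z where "Z i \<omega> = \<bar>x i * \<xi> i \<omega>\<bar>" for i \<omega>
  define w where "w i = 1 / x i" for i
  define Y where "Y \<omega> = (\<Sum>j=1..k. j_min j n (\<lambda>i. Z i \<omega> powr p))" for \<omega>
  define F where "F = (\<Sum>j=1..k. (real k - real j + 1) powr p / b j powr p)"
  have x: "\<And>i. i \<in> {1..n} \<Longrightarrow> 0 < x i"
    and b: "\<And>j. j \<in> {1..n} \<Longrightarrow> b j = (\<Sum>i=j..n. w i)"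
    using assms(7,9) by (auto simp: w_def)
  have w: "\<And>i. i \<in> {1..n} \<Longrightarrow> 0 < w i"
    using x by (simp add: w_def)
  have w_mono: "w j \<le> w i" if "1 \<le> i" "i \<le> j" "j \<le> n" for i j
    using mono_onD[OF assms(8), of i j] x[of i] that by (auto simp: w_def intro!: frac_le)
  have b_nonneg: "0 \<le> b j" if "j \<in> {1..k}" for j
  proof -
    have "0 \<le> (\<Sum>i=j..n. w i)"
      using that by (intro sum_nonneg less_imp_le[OF w]) auto
    then show ?thesis
      using that assms(11) b[of j] by simp
  qed
  have indep: "indep_vars (\<lambda>_. borel) Z {1..n}"
    using indep_vars_compose2[OF assms(5), of "\<lambda>i y. \<bar>x i * y\<bar>" "\<lambda>_. borel"]
    unfolding Z_def by auto
  then have meas: "\<And>i. i \<in> {1..n} \<Longrightarrow> Z i \<in> borel_measurable M"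
    by (simp add: indep_vars_def2)
  have nonneg: "\<And>i \<omega>. 0 \<le> Z i \<omega>"
    by (simp add: Z_def)
  \<comment> \<open>Dividing by \<open>x i\<close> turns the condition on \<open>\<xi> i\<close>
    into one on \<open>Z i\<close>, with \<alpha> and \<beta> both multiplied by
    \<open>w i\<close>.\<close>
  have scale: "Z i \<omega> \<le> t \<longleftrightarrow> \<bar>\<xi> i \<omega>\<bar> \<le> t * w i" if "i \<in> {1..n}" for i \<omega> t
    using x[OF that] by (simp add: Z_def w_def abs_mult field_simps)
  have small: "prob {\<omega>\<in>space M. Z i \<omega> \<le> t} \<le> \<alpha> * t * w i"
    and tail: "prob {\<omega>\<in>space M. Z i \<omega> > t} \<le> exp (- (\<beta> * w i) * t)"
    if "i \<in> {1..n}" "0 \<le> t" for i t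
  proof -
    have "0 \<le> t * w i"
      using that w[of i] by (simp add: less_imp_le)
    then show "prob {\<omega>\<in>space M. Z i \<omega> \<le> t} \<le> \<alpha> * t * w i"
      and "prob {\<omega>\<in>space M. Z i \<omega> > t} \<le> exp (- (\<beta> * w i) * t)"
      using assms(6)[OF that(1)] unfolding alpha_beta_condition_def
      by (auto simp: scale[OF that(1)] mult_ac simp flip: not_le)
  qed
  have F: "(\<Sum>j=1..k. ((real k - real j + 1) / (\<Sum>i=j..n. w i)) powr p) = F"
    unfolding F_def using b b_nonneg assms(11) by (intro sum.cong) (auto simp: powr_divide)
  have "(\<Sum>j=1..k. ((real k - real j + 1) / (2 * \<alpha> * (\<Sum>i=j..n. w i))) powr p)
      = (\<Sum>j=1..k. (1 / (2 * \<alpha>)) powr p * ((real k - real j + 1) powr p / b j powr p))"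
  proof (intro sum.cong refl)
    fix j assume j: "j \<in> {1..k}"
    then have "(\<Sum>i=j..n. w i) = b j"
      using b assms(11) by simp
    then show "((real k - real j + 1) / (2 * \<alpha> * (\<Sum>i=j..n. w i))) powr p
        = (1 / (2 * \<alpha>)) powr p * ((real k - real j + 1) powr p / b j powr p)"
      using b_nonneg[OF j] j assms(3) by (simp add: powr_divide powr_mult)
  qed
  then have "(\<Sum>j=1..k. ((real k - real j + 1) / (2 * \<alpha> * (\<Sum>i=j..n. w i))) powr p)
      = (1 / (2 * \<alpha>)) powr p * F"
    unfolding F_def by (simp only: sum_distrib_left[symmetric])
  then have ge: "ennreal (1 / 2 * ((1 / (2 * \<alpha>)) powr p * F)) \<le> (\<integral>\<^sup>+\<omega>. ennreal (Y \<omega>) \<partial>M)"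
    using nn_integral_sum_j_min_powr_ge_of_small_ball[where Z = Z and w = w,
        OF meas nonneg assms(11,2,3) w small]
    by (simp add: Y_def)
  have le: "(\<integral>\<^sup>+\<omega>. ennreal (Y \<omega>) \<partial>M) \<le> ennreal (W \<beta> p * F)"
    unfolding Y_def F[symmetric]
    by (rule nn_integral_sum_j_min_powr_le_of_exp_tail[where Z = Z and w = w,
        OF indep nonneg assms(10,11,2,4) w w_mono tail])
  have "0 \<le> F"
    unfolding F_def by (intro sum_nonneg) auto
  have "0 \<le> Y \<omega>" for \<omega>
    unfolding Y_def
    by (rule sum_j_min_eq_sum_subset[OF assms(11), of "\<lambda>i. Z i \<omega> powr p"]) (auto intro: sum_nonneg)
  moreover have "Y \<in> borel_measurable M"
    unfolding Y_def using meas by (intro borel_measurable_sum_j_min assms(11)) measurable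
  ultimately have Y: "expectation Y = enn2real (\<integral>\<^sup>+\<omega>. ennreal (Y \<omega>) \<partial>M)"
    by (intro integral_eq_nn_integral) auto
  have W: "0 \<le> W \<beta> p"
    unfolding W_def using assms(2) by (auto intro!: mult_nonneg_nonneg less_imp_le[OF Gamma_real_pos])
  have "expectation Y \<le> W \<beta> p * F"
    unfolding Y using le W \<open>0 \<le> F\<close> by (intro enn2real_leI) auto
  moreover have "1 / 2 * ((1 / (2 * \<alpha>)) powr p * F) \<le> expectation Y"
  proof -
    \<comment> \<open>The upper bound enters the lower one here: \<open>enn2real\<close> sends
      infinity to \<open>0\<close>, so it is monotone only below a finite value.\<close>
    have "(\<integral>\<^sup>+\<omega>. ennreal (Y \<omega>) \<partial>M) < top"
      using le ennreal_less_top le_less_trans by blast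
    then have "enn2real (ennreal (1 / 2 * ((1 / (2 * \<alpha>)) powr p * F))) \<le> expectation Y"
      unfolding Y by (intro enn2real_mono ge)
    then show ?thesis
      using \<open>0 \<le> F\<close> by simp
  qed
  \<comment> \<open>The bound obtained with \<open>2\<close> is relaxed to the constant
    \<open>16\<close> of the statement.\<close>
  moreover have "1 / 2 * (1 / (16 * \<alpha>)) powr p * F \<le> 1 / 2 * ((1 / (2 * \<alpha>)) powr p * F)"
  proof -
    have "(1 / (16 * \<alpha>)) powr p \<le> (1 / (2 * \<alpha>)) powr p"
      using assms(2,3) by (intro powr_mono2 frac_le) auto
    then show ?thesis
      using \<open>0 \<le> F\<close> by (simp add: mult_right_mono)
  qed
  ultimately show ?thesis
    unfolding F_def Y_def Z_def by linarith
qed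

end
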